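(* For all integers $n\geq r\geq 1$, $$\left[ p_{n}^{(r)}\right]_q=\sum_{j=r}^{n}(1-q)^{j-r}\,S_q[j,r]\,p_n^{(j)}.$$
   Context: Let $\Lambda$ be the ring of symmetric functions in infinitely many variables $x_1,x_2,\dots$ with coefficients in $\mathbb{Q}(q)$; $e_n$ are the elementary symmetric functions ($e_0=1$), $E(t)=\sum_{n\geq0}e_nt^n$, and $m_\lambda$ the monomial symmetric functions. For $n\geq r\geq 1$, $p_n^{(r)}=\sum m_\lambda$, the sum over all integer partitions $\lambda$ of $n$ with exactly $r$ parts. For $n\geq1$, $[n]_q=1+q+\dots+q^{n-1}$, $[0]_q=0$, $[n]_q!=[1]_q\cdots[n]_q$, $[0]_q!=1$. The $q$-derivative is $D_qF(t)=\frac{F(qt)-F(t)}{(q-1)t}$, $D_q^0F=F$, $D_q^r=D_q\circ D_q^{r-1}$. The elements $\left[ p_{n}^{(r)}\right]_q$ ($n\geq r\geq0$) are defined by $\sum_{n\geq r}\left[ p_{n}^{(r)}\right]_q(-t)^{n-r}=\frac{1}{[r]_q!}\frac{D_q^rE(t)}{E(t)}$. The Carlitz $q$-Stirling numbers of the second kind $S_q[n,k]$ ($n,k\geq 0$) are defined by $S_q[n,0]=\delta_{n,0}$, $S_q[n,k]=0$ if $k>n$, and $S_q[n,k]=S_q[n-1,k-1]+[k]_qS_q[n-1,k]$ for $n\geq k\geq 1$. *)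

theory Defs
  imports
    "HOL-Library.Poly_Mapping"
    "HOL-Library.Multiset"
    "HOL-Computational_Algebra.Computational_Algebra"
begin

section \<open>Monomials in infinitely many variables\<close>

text \<open>
  A monomial in the variables \<open>x\<^sub>0, x\<^sub>1, \<dots>\<close> (indexed from \<open>0\<close>) is its finitely supported
  exponent function; multiplication of monomials is addition of exponents.
\<close>

type_synonym mon = "nat \<Rightarrow>\<^sub>0 nat"

definition mon_exps :: "mon \<Rightarrow> nat multiset" where
  "mon_exps \<mu> = image_mset (Poly_Mapping.lookup \<mu>) (mset_set (Poly_Mapping.keys \<mu>))"

definition mon_deg :: "mon \<Rightarrow> nat" where
  "mon_deg \<mu> = (\<Sum>i\<in>Poly_Mapping.keys \<mu>. Poly_Mapping.lookup \<mu> i)"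

definition mon_splits :: "mon \<Rightarrow> (mon \<times> mon) set" where
  "mon_splits \<mu> = {(\<alpha>, \<beta>). \<alpha> + \<beta> = \<mu>}"

lemma mem_mon_splits [simp]: "(\<alpha>, \<beta>) \<in> mon_splits \<mu> \<longleftrightarrow> \<alpha> + \<beta> = \<mu>"
  by (simp add: mon_splits_def)

lemma sum_mset_mon_exps: "sum_mset (mon_exps \<mu>) = mon_deg \<mu>"
  by (simp add: mon_exps_def mon_deg_def sum_unfold_sum_mset)

lemma size_mon_exps: "size (mon_exps \<mu>) = card (Poly_Mapping.keys \<mu>)"
  by (simp add: mon_exps_def)

lemma mon_deg_superset:
  assumes "finite A" "Poly_Mapping.keys \<mu> \<subseteq> A"
  shows "mon_deg \<mu> = (\<Sum>i\<in>A. Poly_Mapping.lookup \<mu> i)"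
  unfolding mon_deg_def
  by (rule sum.mono_neutral_left) (use assms in \<open>auto simp: not_in_keys_iff_lookup_eq_zero\<close>)

lemma mon_deg_add: "mon_deg (\<alpha> + \<beta>) = mon_deg \<alpha> + mon_deg \<beta>"
proof -
  let ?A = "Poly_Mapping.keys \<alpha> \<union> Poly_Mapping.keys \<beta>"
  have "mon_deg (\<alpha> + \<beta>) = (\<Sum>i\<in>?A. Poly_Mapping.lookup (\<alpha> + \<beta>) i)"
    by (rule mon_deg_superset) (use Poly_Mapping.keys_add[of \<alpha> \<beta>] in auto)
  also have "\<dots> = (\<Sum>i\<in>?A. Poly_Mapping.lookup \<alpha> i) + (\<Sum>i\<in>?A. Poly_Mapping.lookup \<beta> i)"
    by (simp add: lookup_add sum.distrib)
  also have "(\<Sum>i\<in>?A. Poly_Mapping.lookup \<alpha> i) = mon_deg \<alpha>"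
    by (rule mon_deg_superset [symmetric]) auto
  also have "(\<Sum>i\<in>?A. Poly_Mapping.lookup \<beta> i) = mon_deg \<beta>"
    by (rule mon_deg_superset [symmetric]) auto
  finally show ?thesis .
qed

lemma mon_deg_0 [simp]: "mon_deg 0 = 0"
  by (simp add: mon_deg_def)

lemma finite_mon_splits [simp]: "finite (mon_splits \<mu>)"
proof -
  let ?K = "Poly_Mapping.keys \<mu>"
  let ?F = "{f. \<forall>i. (i \<in> ?K \<longrightarrow> f i \<in> {..mon_deg \<mu>}) \<and> (i \<notin> ?K \<longrightarrow> f i = (0::nat))}"
  have fin: "finite ?F"
    by (rule finite_set_of_finite_funs) auto
  have le: "Poly_Mapping.lookup \<alpha> i \<le> Poly_Mapping.lookup \<mu> i" if "\<alpha> + \<beta> = \<mu>" for \<alpha> \<beta> i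
    using that by (auto simp: lookup_add)
  have deg: "Poly_Mapping.lookup \<mu> i \<le> mon_deg \<mu>" if "i \<in> ?K" for i
    unfolding mon_deg_def by (rule member_le_sum[OF that]) simp_all
  have "Poly_Mapping.lookup \<alpha> \<in> ?F" if "\<alpha> + \<beta> = \<mu>" for \<alpha> \<beta>
  proof (intro CollectI allI conjI impI)
    fix i
    show "Poly_Mapping.lookup \<alpha> i \<in> {..mon_deg \<mu>}" if "i \<in> ?K"
      using le[OF \<open>\<alpha> + \<beta> = \<mu>\<close>, of i] deg[OF that] by simp
    show "Poly_Mapping.lookup \<alpha> i = 0" if "i \<notin> ?K"
      using le[OF \<open>\<alpha> + \<beta> = \<mu>\<close>, of i] that by (simp add: not_in_keys_iff_lookup_eq_zero)
  qed
  then have sub: "Poly_Mapping.lookup ` (fst ` mon_splits \<mu>) \<subseteq> ?F"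
    by (force simp: mon_splits_def)
  have "inj_on Poly_Mapping.lookup (fst ` mon_splits \<mu>)"
    by (rule inj_onI) (rule iffD1[OF lookup_inject])
  with finite_subset[OF sub fin] have "finite (fst ` mon_splits \<mu>)"
    by (rule finite_imageD)
  moreover have "inj_on fst (mon_splits \<mu>)"
    by (auto simp: inj_on_def mon_splits_def)
  ultimately show ?thesis by (rule finite_imageD)
qed

lemma mon_splits_0: "mon_splits (0 :: mon) = {(0, 0)}"
proof (rule equalityI; clarsimp simp: mon_splits_def)
  fix \<alpha> \<beta> :: mon assume "\<alpha> + \<beta> = 0"
  then have "Poly_Mapping.lookup \<alpha> i + Poly_Mapping.lookup \<beta> i = 0" for i
    by (metis lookup_add lookup_zero)
  then show "\<alpha> = 0 \<and> \<beta> = 0"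
    by (auto intro!: poly_mapping_eqI)
qed

lemma map_key_inv:
  assumes "bij (\<pi> :: nat \<Rightarrow> nat)"
  shows "Poly_Mapping.map_key \<pi> (Poly_Mapping.map_key (inv \<pi>) (\<mu> :: mon)) = \<mu>"
    and "Poly_Mapping.map_key (inv \<pi>) (Poly_Mapping.map_key \<pi> \<mu>) = \<mu>"
  using assms bij_is_inj[OF assms] bij_is_inj[OF bij_imp_bij_inv[OF assms]]
  by (auto intro!: poly_mapping_eqI simp: map_key.rep_eq bij_is_surj surj_f_inv_f)

lemma map_key_eq_0_iff:
  assumes "bij (\<pi> :: nat \<Rightarrow> nat)"
  shows "Poly_Mapping.map_key \<pi> (\<mu> :: mon) = 0 \<longleftrightarrow> \<mu> = 0"
  by (metis assms map_key_inv(2) map_key_zero bij_imp_bij_inv bij_is_inj)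

lemma mon_exps_map_key:
  assumes "bij (\<pi> :: nat \<Rightarrow> nat)"
  shows "mon_exps (Poly_Mapping.map_key \<pi> \<mu>) = mon_exps \<mu>"
proof -
  have inj: "inj \<pi>" using assms by (rule bij_is_inj)
  have k: "Poly_Mapping.keys (Poly_Mapping.map_key \<pi> \<mu>) = \<pi> -` Poly_Mapping.keys \<mu>"
    by (rule keys_map_key[OF inj])
  have img: "\<pi> ` (\<pi> -` Poly_Mapping.keys \<mu>) = Poly_Mapping.keys \<mu>"
    using assms by (simp add: bij_is_surj)
  have "image_mset \<pi> (mset_set (\<pi> -` Poly_Mapping.keys \<mu>)) = mset_set (Poly_Mapping.keys \<mu>)"
    using image_mset_mset_set[of \<pi> "\<pi> -` Poly_Mapping.keys \<mu>"] inj img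
    by (simp add: inj_on_subset)
  then have "mon_exps \<mu> =
      image_mset (Poly_Mapping.lookup \<mu>) (image_mset \<pi> (mset_set (\<pi> -` Poly_Mapping.keys \<mu>)))"
    by (simp add: mon_exps_def)
  then show ?thesis
    by (simp add: mon_exps_def k map_key.rep_eq inj image_mset.compositionality o_def)
qed


section \<open>The ring of symmetric functions\<close>

text \<open>
  A symmetric function is a formal power series in \<open>x\<^sub>0, x\<^sub>1, \<dots>\<close>, given by its coefficient
  function, that has bounded degree and is invariant under all permutations of the variables.
\<close>

definition is_symmetric :: "(mon \<Rightarrow> 'a :: comm_ring_1) \<Rightarrow> bool" where
  "is_symmetric f \<longleftrightarrow>
     (\<exists>d. \<forall>\<mu>. f \<mu> \<noteq> 0 \<longrightarrow> mon_deg \<mu> \<le> d) \<and>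
     (\<forall>\<pi> \<mu>. bij \<pi> \<longrightarrow> f (Poly_Mapping.map_key \<pi> \<mu>) = f \<mu>)"

lemma is_symmetricI:
  assumes "\<And>\<mu>. f \<mu> \<noteq> 0 \<Longrightarrow> mon_deg \<mu> \<le> d"
    and "\<And>\<pi> \<mu>. bij \<pi> \<Longrightarrow> f (Poly_Mapping.map_key \<pi> \<mu>) = f \<mu>"
  shows "is_symmetric f"
  using assms unfolding is_symmetric_def by blast

lemma is_symmetricE:
  assumes "is_symmetric f"
  obtains d where "\<And>\<mu>. f \<mu> \<noteq> 0 \<Longrightarrow> mon_deg \<mu> \<le> d"
    and "\<And>\<pi> \<mu>. bij \<pi> \<Longrightarrow> f (Poly_Mapping.map_key \<pi> \<mu>) = f \<mu>"
  using assms unfolding is_symmetric_def by blast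

lemma is_symmetric_const: "is_symmetric (\<lambda>\<mu>. if \<mu> = 0 then c else 0)"
  by (rule is_symmetricI[where d = 0]) (auto simp: map_key_eq_0_iff split: if_splits)

lemma is_symmetric_add:
  assumes "is_symmetric f" "is_symmetric g"
  shows "is_symmetric (\<lambda>\<mu>. f \<mu> + g \<mu>)"
proof -
  obtain a where f: "\<And>\<mu>. f \<mu> \<noteq> 0 \<Longrightarrow> mon_deg \<mu> \<le> a"
    "\<And>\<pi> \<mu>. bij \<pi> \<Longrightarrow> f (Poly_Mapping.map_key \<pi> \<mu>) = f \<mu>"
    using is_symmetricE[OF assms(1)] by blast
  obtain b where g: "\<And>\<mu>. g \<mu> \<noteq> 0 \<Longrightarrow> mon_deg \<mu> \<le> b"
    "\<And>\<pi> \<mu>. bij \<pi> \<Longrightarrow> g (Poly_Mapping.map_key \<pi> \<mu>) = g \<mu>"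
    using is_symmetricE[OF assms(2)] by blast
  show ?thesis
  proof (rule is_symmetricI)
    fix \<mu> assume "f \<mu> + g \<mu> \<noteq> 0"
    then have "f \<mu> \<noteq> 0 \<or> g \<mu> \<noteq> 0" by auto
    then show "mon_deg \<mu> \<le> max a b" using f(1)[of \<mu>] g(1)[of \<mu>] by linarith
  qed (simp add: f(2) g(2))
qed

lemma is_symmetric_uminus: "is_symmetric f \<Longrightarrow> is_symmetric (\<lambda>\<mu>. - f \<mu>)"
  by (simp add: is_symmetric_def)

lemma is_symmetric_mult:
  assumes "is_symmetric f" "is_symmetric g"
  shows "is_symmetric (\<lambda>\<mu>. \<Sum>(\<alpha>, \<beta>)\<in>mon_splits \<mu>. f \<alpha> * g \<beta>)"
proof -
  obtain a where f: "\<And>\<mu>. f \<mu> \<noteq> 0 \<Longrightarrow> mon_deg \<mu> \<le> a"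
    "\<And>\<pi> \<mu>. bij \<pi> \<Longrightarrow> f (Poly_Mapping.map_key \<pi> \<mu>) = f \<mu>"
    using is_symmetricE[OF assms(1)] by blast
  obtain b where g: "\<And>\<mu>. g \<mu> \<noteq> 0 \<Longrightarrow> mon_deg \<mu> \<le> b"
    "\<And>\<pi> \<mu>. bij \<pi> \<Longrightarrow> g (Poly_Mapping.map_key \<pi> \<mu>) = g \<mu>"
    using is_symmetricE[OF assms(2)] by blast
  show ?thesis
  proof (rule is_symmetricI)
    fix \<mu> assume "(\<Sum>(\<alpha>, \<beta>)\<in>mon_splits \<mu>. f \<alpha> * g \<beta>) \<noteq> 0"
    then obtain p where "p \<in> mon_splits \<mu>" "(case p of (\<alpha>, \<beta>) \<Rightarrow> f \<alpha> * g \<beta>) \<noteq> 0"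
      by (rule sum.not_neutral_contains_not_neutral)
    then obtain \<alpha> \<beta> where "\<alpha> + \<beta> = \<mu>" "f \<alpha> * g \<beta> \<noteq> 0"
      by (cases p) auto
    then have "f \<alpha> \<noteq> 0" "g \<beta> \<noteq> 0" by auto
    with f(1)[of \<alpha>] g(1)[of \<beta>] \<open>\<alpha> + \<beta> = \<mu>\<close> show "mon_deg \<mu> \<le> a + b"
      by (auto simp: mon_deg_add)
  next
    fix \<pi> :: "nat \<Rightarrow> nat" and \<mu> assume bij: "bij \<pi>"
    let ?k = "Poly_Mapping.map_key \<pi> :: mon \<Rightarrow> mon"
    let ?k' = "Poly_Mapping.map_key (inv \<pi>) :: mon \<Rightarrow> mon"
    have bij': "bij (inv \<pi>)" using bij by (rule bij_imp_bij_inv)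
    have k: "?k (\<alpha> + \<beta>) = ?k \<alpha> + ?k \<beta>" for \<alpha> \<beta>
      using bij by (intro map_key_plus bij_is_inj)
    have k': "?k' (\<alpha> + \<beta>) = ?k' \<alpha> + ?k' \<beta>" for \<alpha> \<beta>
      using bij' by (intro map_key_plus bij_is_inj)
    have split': "?k' \<alpha> + ?k' \<beta> = \<mu>" if "\<alpha> + \<beta> = ?k \<mu>" for \<alpha> \<beta>
      by (metis that k' map_key_inv(2)[OF bij])
    have inv': "f (?k' \<alpha>) = f \<alpha>" "g (?k' \<alpha>) = g \<alpha>" for \<alpha>
      using f(2)[OF bij'] g(2)[OF bij'] by auto
    show "(\<Sum>(\<alpha>, \<beta>)\<in>mon_splits (?k \<mu>). f \<alpha> * g \<beta>) = (\<Sum>(\<alpha>, \<beta>)\<in>mon_splits \<mu>. f \<alpha> * g \<beta>)"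
    proof (rule sum.reindex_bij_witness[of _ "\<lambda>(\<alpha>, \<beta>). (?k \<alpha>, ?k \<beta>)" "\<lambda>(\<alpha>, \<beta>). (?k' \<alpha>, ?k' \<beta>)"],
        goal_cases)
      case (1 p) then show ?case by (cases p) (simp add: map_key_inv[OF bij])
    next
      case (2 p) then show ?case by (cases p) (simp add: split')
    next
      case (3 p) then show ?case by (cases p) (simp add: map_key_inv[OF bij])
    next
      case (4 p) then show ?case by (cases p) (simp flip: k)
    next
      case (5 p) then show ?case by (cases p) (simp add: inv')
    qed
  qed
qed

typedef (overloaded) 'a symfun = "{f :: mon \<Rightarrow> 'a :: comm_ring_1. is_symmetric f}"
  morphisms sf_coeff Abs_symfun
  using is_symmetric_const by blast

setup_lifting type_definition_symfun

lemma symfun_eqI: "(\<And>\<mu>. sf_coeff f \<mu> = sf_coeff g \<mu>) \<Longrightarrow> f = g"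
  by (rule iffD1[OF sf_coeff_inject]) (rule ext)

lift_definition sf_const :: "'a :: comm_ring_1 \<Rightarrow> 'a symfun" is
  "\<lambda>c \<mu>. if \<mu> = 0 then c else 0"
  by (rule is_symmetric_const)

instantiation symfun :: (comm_ring_1) comm_ring_1
begin

lift_definition zero_symfun :: "'a symfun" is "\<lambda>_. 0"
  using is_symmetric_const[of 0] by simp

lift_definition one_symfun :: "'a symfun" is "\<lambda>\<mu>. if \<mu> = 0 then 1 else 0"
  by (rule is_symmetric_const)

lift_definition plus_symfun :: "'a symfun \<Rightarrow> 'a symfun \<Rightarrow> 'a symfun" is
  "\<lambda>f g \<mu>. f \<mu> + g \<mu>"
  by (rule is_symmetric_add)

lift_definition uminus_symfun :: "'a symfun \<Rightarrow> 'a symfun" is "\<lambda>f \<mu>. - f \<mu>"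
  by (rule is_symmetric_uminus)

definition minus_symfun :: "'a symfun \<Rightarrow> 'a symfun \<Rightarrow> 'a symfun" where
  "minus_symfun f g = f + - g"

lift_definition times_symfun :: "'a symfun \<Rightarrow> 'a symfun \<Rightarrow> 'a symfun" is
  "\<lambda>f g \<mu>. \<Sum>(\<alpha>, \<beta>)\<in>mon_splits \<mu>. f \<alpha> * g \<beta>"
  by (rule is_symmetric_mult)

instance
proof
  fix a b c :: "'a symfun"
  show "a + b + c = a + (b + c)" by transfer (simp add: add.assoc)
  show "a + b = b + a" by transfer (simp add: add.commute)
  show "0 + a = a" by transfer simp
  show "- a + a = 0" by transfer simp
  show "a - b = a + - b" by (rule minus_symfun_def)
  show "(0::'a symfun) \<noteq> 1" by transfer (auto dest: fun_cong[where x = 0])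
  show "(a + b) * c = a * c + b * c"
    by transfer (simp add: distrib_right sum.distrib case_prod_unfold)
  show "a * b = b * a"
  proof (transfer, rule ext)
    fix f g :: "mon \<Rightarrow> 'a" and \<mu>
    show "(\<Sum>(\<alpha>, \<beta>)\<in>mon_splits \<mu>. f \<alpha> * g \<beta>) = (\<Sum>(\<alpha>, \<beta>)\<in>mon_splits \<mu>. g \<alpha> * f \<beta>)"
      by (rule sum.reindex_bij_witness[of _ prod.swap prod.swap])
        (auto simp: add.commute mult.commute)
  qed
  show "1 * a = a"
  proof (transfer, rule ext)
    fix f :: "mon \<Rightarrow> 'a" and \<mu>
    have "(\<Sum>(\<alpha>, \<beta>)\<in>mon_splits \<mu>. (if \<alpha> = 0 then 1 else 0) * f \<beta>) =
        (\<Sum>(\<alpha>, \<beta>)\<in>{(0 :: mon, \<mu>)}. (if \<alpha> = 0 then 1 else 0) * f \<beta>)"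
      by (rule sum.mono_neutral_right) (auto split: if_splits)
    then show "(\<Sum>(\<alpha>, \<beta>)\<in>mon_splits \<mu>. (if \<alpha> = 0 then 1 else 0) * f \<beta>) = f \<mu>"
      by simp
  qed
  show "a * b * c = a * (b * c)"
  proof (transfer, rule ext)
    fix f g h :: "mon \<Rightarrow> 'a" and \<mu>
    have "(\<Sum>(\<alpha>, \<beta>)\<in>mon_splits \<mu>. (\<Sum>(\<gamma>, \<delta>)\<in>mon_splits \<alpha>. f \<gamma> * g \<delta>) * h \<beta>) =
        (\<Sum>p\<in>mon_splits \<mu>. \<Sum>q\<in>mon_splits (fst p). f (fst q) * g (snd q) * h (snd p))"
      by (simp add: sum_distrib_right case_prod_unfold)
    also have "\<dots> = (\<Sum>(p, q)\<in>(SIGMA p:mon_splits \<mu>. mon_splits (fst p)).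
        f (fst q) * g (snd q) * h (snd p))"
      by (rule sum.Sigma) auto
    also have "\<dots> = (\<Sum>(p, q)\<in>(SIGMA p:mon_splits \<mu>. mon_splits (snd p)).
        f (fst p) * (g (fst q) * h (snd q)))"
      by (rule sum.reindex_bij_witness[of _
            "\<lambda>((\<alpha>, \<beta>), (\<gamma>, \<delta>)). ((\<alpha> + \<gamma>, \<delta>), (\<alpha>, \<gamma>))"
            "\<lambda>((\<alpha>, \<beta>), (\<gamma>, \<delta>)). ((\<gamma>, \<delta> + \<beta>), (\<delta>, \<beta>))"])
        (auto simp: add.assoc mult.assoc)
    also have "\<dots> = (\<Sum>p\<in>mon_splits \<mu>. \<Sum>q\<in>mon_splits (snd p). f (fst p) * (g (fst q) * h (snd q)))"
      by (rule sum.Sigma [symmetric]) auto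
    also have "\<dots> = (\<Sum>(\<alpha>, \<beta>)\<in>mon_splits \<mu>. f \<alpha> * (\<Sum>(\<gamma>, \<delta>)\<in>mon_splits \<beta>. g \<gamma> * h \<delta>))"
      by (simp add: sum_distrib_left case_prod_unfold)
    finally show "(\<Sum>(\<alpha>, \<beta>)\<in>mon_splits \<mu>. (\<Sum>(\<gamma>, \<delta>)\<in>mon_splits \<alpha>. f \<gamma> * g \<delta>) * h \<beta>) =
        (\<Sum>(\<alpha>, \<beta>)\<in>mon_splits \<mu>. f \<alpha> * (\<Sum>(\<gamma>, \<delta>)\<in>mon_splits \<beta>. g \<gamma> * h \<delta>))" .
  qed
qed

end

lemma sf_coeff_const_mult: "sf_coeff (sf_const c * f) \<mu> = c * sf_coeff f \<mu>"
proof transfer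
  fix c :: 'a and f :: "mon \<Rightarrow> 'a" and \<mu>
  have "(\<Sum>(\<alpha>, \<beta>)\<in>mon_splits \<mu>. (if \<alpha> = 0 then c else 0) * f \<beta>) =
      (\<Sum>(\<alpha>, \<beta>)\<in>{(0 :: mon, \<mu>)}. (if \<alpha> = 0 then c else 0) * f \<beta>)"
    by (rule sum.mono_neutral_right) (auto split: if_splits)
  then show "(\<Sum>(\<alpha>, \<beta>)\<in>mon_splits \<mu>. (if \<alpha> = 0 then c else 0) * f \<beta>) = c * f \<mu>"
    by simp
qed

lemma sf_const_0 [simp]: "sf_const 0 = 0"
  by transfer auto

lemma sf_const_1 [simp]: "sf_const 1 = 1"
  by transfer auto

lemma sf_const_add: "sf_const (a + b) = sf_const a + sf_const b"
  by transfer auto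

lemma sf_const_uminus: "sf_const (- a) = - sf_const a"
  by transfer auto

lemma sf_const_mult: "sf_const (a * b) = sf_const a * sf_const b"
  by (rule symfun_eqI, subst sf_coeff_const_mult) (simp add: sf_const.rep_eq)

lift_definition sf_e :: "nat \<Rightarrow> 'a :: comm_ring_1 symfun" is
  "\<lambda>n \<mu>. if card (Poly_Mapping.keys \<mu>) = n \<and>
             (\<forall>i\<in>Poly_Mapping.keys \<mu>. Poly_Mapping.lookup \<mu> i = 1) then 1 else 0"
proof -
  fix n :: nat
  let ?P = "\<lambda>\<mu> :: mon. card (Poly_Mapping.keys \<mu>) = n \<and>
    (\<forall>i\<in>Poly_Mapping.keys \<mu>. Poly_Mapping.lookup \<mu> i = 1)"
  show "is_symmetric (\<lambda>\<mu>. if ?P \<mu> then 1 else 0 :: 'a)"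
  proof (rule is_symmetricI[where d = n])
    fix \<mu> assume "(if ?P \<mu> then 1 else 0 :: 'a) \<noteq> 0"
    then show "mon_deg \<mu> \<le> n" by (auto simp: mon_deg_def split: if_splits)
  next
    fix \<pi> :: "nat \<Rightarrow> nat" and \<mu> assume "bij \<pi>"
    have P: "?P \<nu> \<longleftrightarrow> size (mon_exps \<nu>) = n \<and> (\<forall>k\<in>#mon_exps \<nu>. k = 1)" for \<nu>
      by (auto simp: mon_exps_def)
    show "(if ?P (Poly_Mapping.map_key \<pi> \<mu>) then 1 else 0 :: 'a) = (if ?P \<mu> then 1 else 0)"
      by (simp only: P mon_exps_map_key[OF \<open>bij \<pi>\<close>])
  qed
qed

text \<open>
  A partition is the multiset of its (positive) parts, so the monomials of
  \<open>m\<^sub>\<lambda>\<close> are those whose multiset of nonzero exponents is \<open>\<lambda>\<close> (\<open>L\<close> below, \<open>\<lambda>\<close> being reserved).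
\<close>

lift_definition sf_m :: "nat multiset \<Rightarrow> 'a :: comm_ring_1 symfun" is
  "\<lambda>L \<mu>. if mon_exps \<mu> = L then 1 else 0"
proof -
  fix L :: "nat multiset"
  show "is_symmetric (\<lambda>\<mu>. if mon_exps \<mu> = L then 1 else 0 :: 'a)"
    by (rule is_symmetricI[where d = "sum_mset L"])
      (auto simp: mon_exps_map_key sum_mset_mon_exps[symmetric] split: if_splits)
qed

definition partitions_parts :: "nat \<Rightarrow> nat \<Rightarrow> nat multiset set" where
  "partitions_parts n r = {L. 0 \<notin># L \<and> sum_mset L = n \<and> size L = r}"

lemma finite_partitions_parts [simp]: "finite (partitions_parts n r)"
proof (rule finite_subset)
  show "partitions_parts n r \<subseteq> mset ` {xs. set xs \<subseteq> {..n} \<and> length xs = r}"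
  proof
    fix M assume M: "M \<in> partitions_parts n r"
    obtain xs where xs: "mset xs = M" using ex_mset by blast
    have "set xs \<subseteq> {..n}" "length xs = r"
      using M xs by (auto simp: partitions_parts_def sum_mset_sum_list intro: member_le_sum_list)
    with xs show "M \<in> mset ` {xs. set xs \<subseteq> {..n} \<and> length xs = r}" by blast
  qed
  show "finite (mset ` {xs. set xs \<subseteq> {..n} \<and> length xs = r})"
    by (intro finite_imageI finite_lists_length_eq) auto
qed

definition sf_p :: "nat \<Rightarrow> nat \<Rightarrow> 'a :: comm_ring_1 symfun" where
  "sf_p n r = (\<Sum>L\<in>partitions_parts n r. sf_m L)"


section \<open>\<open>q\<close>-analogues\<close>

definition q_int :: "'a :: comm_ring_1 \<Rightarrow> nat \<Rightarrow> 'a" where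
  "q_int q n = (\<Sum>i<n. q ^ i)"

definition q_fact :: "'a :: comm_ring_1 \<Rightarrow> nat \<Rightarrow> 'a" where
  "q_fact q n = (\<Prod>i=1..n. q_int q i)"

fun q_stirling2 :: "'a :: comm_ring_1 \<Rightarrow> nat \<Rightarrow> nat \<Rightarrow> 'a" where
  "q_stirling2 q n 0 = (if n = 0 then 1 else 0)"
| "q_stirling2 q 0 (Suc k) = 0"
| "q_stirling2 q (Suc n) (Suc k) =
     (if k > n then 0 else q_stirling2 q n k + q_int q (Suc k) * q_stirling2 q n (Suc k))"

text \<open>
  \<open>F(qt)\<close> is \<open>fps_compose F (fps_const (sf_const q) * fps_X)\<close>. Since \<open>F(qt) - F(t)\<close> has no
  constant term, \<open>fps_shift 1\<close> divides it exactly by \<open>t\<close>.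
\<close>

definition q_deriv :: "'a :: field \<Rightarrow> 'a symfun fps \<Rightarrow> 'a symfun fps" where
  "q_deriv q F = fps_const (sf_const (1 / (q - 1))) *
     fps_shift 1 (fps_compose F (fps_const (sf_const q) * fps_X) - F)"

lemma q_deriv_correct:
  assumes "q \<noteq> 1"
  shows "fps_const (sf_const (q - 1)) * fps_X * q_deriv q F =
         fps_compose F (fps_const (sf_const q) * fps_X) - F"
proof -
  let ?G = "fps_compose F (fps_const (sf_const q) * fps_X) - F"
  have c: "sf_const (q - 1) * sf_const (1 / (q - 1)) = 1"
    using assms by (simp flip: sf_const_mult)
  have X: "fps_X * fps_shift 1 ?G = ?G"
    by (rule fps_ext) (simp add: fps_X_mult_nth)
  have "fps_const (sf_const (q - 1)) * fps_X * q_deriv q F =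
      (fps_const (sf_const (q - 1)) * fps_const (sf_const (1 / (q - 1)))) * (fps_X * fps_shift 1 ?G)"
    unfolding q_deriv_def by (simp only: mult_ac)
  also have "\<dots> = ?G"
    by (simp only: fps_const_mult c X fps_const_1_eq_1 mult_1_left)
  finally show ?thesis .
qed

definition sf_E :: "'a :: comm_ring_1 symfun fps" where
  "sf_E = Abs_fps sf_e"

lemma sf_e_0 [simp]: "sf_e 0 = 1"
  by transfer auto

lemma sf_E_nth_0 [simp]: "fps_nth sf_E 0 = 1"
  by (simp add: sf_E_def)

text \<open>
  The coefficient ring of \<open>sf_E\<close> is not a field, so \<open>1 / E(t)\<close> is \<open>fps_right_inverse sf_E 1\<close>,
  the inverse of \<open>sf_E\<close> with constant term \<open>1\<close>.
\<close>

lemma sf_E_inverse: "sf_E * fps_right_inverse sf_E 1 = 1"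
  by (rule fps_right_inverse) simp

definition sf_p_gf :: "'a :: field \<Rightarrow> nat \<Rightarrow> 'a symfun fps" where
  "sf_p_gf q r = fps_const (sf_const (1 / q_fact q r)) *
     ((q_deriv q ^^ r) sf_E * fps_right_inverse sf_E 1)"

text \<open>
  For \<open>n \<ge> r\<close>, comparing coefficients of \<open>t\<^bsup>n-r\<^esup>\<close> in the generating function
  \<open>\<Sum>n\<ge>r. [p\<^sub>n\<^bsup>(r)\<^esup>]\<^sub>q (-t)\<^bsup>n-r\<^esup>\<close>; the value is irrelevant for \<open>n < r\<close>.
\<close>

definition q_p :: "'a :: field \<Rightarrow> nat \<Rightarrow> nat \<Rightarrow> 'a symfun" where
  "q_p q n r = (- 1) ^ (n - r) * fps_nth (sf_p_gf q r) (n - r)"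

lemma q_p_gf: "Abs_fps (\<lambda>k. q_p q (r + k) r * (- 1) ^ k) = sf_p_gf q r"
proof (rule fps_ext)
  fix k
  have "(- 1) ^ k * (- 1) ^ k = (1 :: 'a symfun)"
    by (simp flip: power_mult_distrib)
  then have "(- 1) ^ k * x * (- 1) ^ k = x" for x :: "'a symfun"
    by (metis mult.commute mult.left_commute mult_1_right)
  then show "fps_nth (Abs_fps (\<lambda>k. q_p q (r + k) r * (- 1) ^ k)) k = fps_nth (sf_p_gf q r) k"
    by (simp only: fps_nth_Abs_fps q_p_def add_diff_cancel_left')
qed


section \<open>The coefficient field \<open>\<rat>(q)\<close>\<close>

type_synonym rat_q = "rat poly fract"

definition qq :: rat_q where
  "qq = to_fract [:0, 1:]"

end

theory Submission
  imports Defs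
begin

text \<open>
  After multiplication by \<open>E(t)\<close> the claim is compared at each monomial \<open>\<mu>\<close> of degree \<open>m + r\<close>.
  Multiplying by \<open>e\<^sub>a\<close> sums over the sets \<open>A\<close> of \<open>a\<close> variables dividing \<open>\<mu>\<close>, so the right-hand
  side is a signed sum over all such \<open>A\<close> of a weight depending only on the number of variables
  left in \<open>\<mu> / x\<^sub>A\<close>. Toggling a variable of exponent at least \<open>2\<close> in \<open>A\<close> changes the sign only, so
  the sum vanishes unless \<open>\<mu>\<close> is squarefree. In the squarefree case it is Carlitz's
  identity \<open>\<Sum>\<^sub>j (N choose j) (q - 1)\<^bsup>j-r\<^esup> S\<^sub>q[j, r] = (N choose r)\<^sub>q\<close>, which follows from the
  \<open>q\<close>-Pascal recurrence.
\<close>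

section \<open>Carlitz's identity\<close>

lemma q_int_0 [simp]: "q_int q 0 = 0"
  by (simp add: q_int_def)

lemma q_int_add: "q_int q (m + n) = q_int q m + q ^ m * q_int q n"
  by (induction n) (simp_all add: q_int_def algebra_simps power_add)

lemma q_int_geometric: "(q - 1) * q_int q n = q ^ n - 1"
  by (simp add: q_int_def power_diff_1_eq)

lemma q_fact_Suc: "q_fact q (Suc n) = q_int q (Suc n) * q_fact q n"
  by (simp add: q_fact_def mult.commute)

lemma q_stirling2_eq_0: "n < k \<Longrightarrow> q_stirling2 q n k = 0"
  by (cases n; cases k) auto

lemma q_stirling2_Suc_Suc:
  "q_stirling2 q (Suc n) (Suc k) = q_stirling2 q n k + q_int q (Suc k) * q_stirling2 q n (Suc k)"
  by (simp add: q_stirling2_eq_0)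

text \<open>The \<open>q\<close>-falling factorial: \<open>q_fact q r\<close> times the Gaussian
  binomial coefficient, kept free of division so that it makes sense in every commutative ring. For
  \<open>n < r\<close> the factor with \<open>i = n\<close> makes it zero.\<close>

definition q_ffact :: "'a :: comm_ring_1 \<Rightarrow> nat \<Rightarrow> nat \<Rightarrow> 'a" where
  "q_ffact q n r = (\<Prod>i<r. q_int q (n - i))"

lemma q_ffact_Suc: "q_ffact q n (Suc r) = q_ffact q n r * q_int q (n - r)"
  by (simp add: q_ffact_def)

lemma q_ffact_Suc_Suc: "q_ffact q (Suc n) (Suc r) = q_int q (Suc n) * q_ffact q n r"
  unfolding q_ffact_def by (subst prod.lessThan_Suc_shift) simp

lemma q_ffact_eq_0: "n < r \<Longrightarrow> q_ffact q n r = 0"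
  by (auto simp: q_ffact_def intro!: prod_zero bexI[of _ n])

text \<open>The Pascal rule for Gaussian binomials with denominators cleared; it comes from
  \<open>[n+1] = [r+1] + q^(r+1) [n-r]\<close>.\<close>

lemma q_ffact_pascal:
  "q_ffact q (Suc n) (Suc r) = q_int q (Suc r) * q_ffact q n r + q ^ Suc r * q_ffact q n (Suc r)"
proof (cases "r \<le> n")
  case True
  then have "q_int q (Suc n) = q_int q (Suc r) + q ^ Suc r * q_int q (n - r)"
    using q_int_add[of q "Suc r" "n - r"] by simp
  then show ?thesis
    unfolding q_ffact_Suc_Suc unfolding q_ffact_Suc by (simp add: algebra_simps)
next
  case False
  then show ?thesis by (simp add: q_ffact_Suc_Suc q_ffact_eq_0)
qed

text \<open>Terms with \<open>j < r\<close>, where \<open>j - r\<close> is truncated to 0, vanish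
  with the Stirling number. Starting at 0 lets the ordinary Pascal rule act on the whole
  sum.\<close>

definition carlitz_sum :: "'a :: comm_ring_1 \<Rightarrow> nat \<Rightarrow> nat \<Rightarrow> 'a" where
  "carlitz_sum q n r = (\<Sum>j\<le>n. of_nat (n choose j) * ((q - 1) ^ (j - r) * q_stirling2 q j r))"

lemma sum_choose_Suc:
  fixes f :: "nat \<Rightarrow> 'a :: comm_ring_1"
  shows "(\<Sum>j\<le>Suc n. of_nat (Suc n choose j) * f j) =
    (\<Sum>j\<le>n. of_nat (n choose j) * f j) + (\<Sum>j\<le>n. of_nat (n choose j) * f (Suc j))"
proof -
  \<comment> \<open>The added term has \<open>n choose Suc n = 0\<close>; with it the index range
    can be shifted.\<close>
  have "(\<Sum>j\<le>n. of_nat (n choose j) * f j) = (\<Sum>j\<le>Suc n. of_nat (n choose j) * f j)"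
    by (simp add: binomial_eq_0)
  also have "\<dots> = f 0 + (\<Sum>j\<le>n. of_nat (n choose Suc j) * f (Suc j))"
    by (subst sum.atMost_Suc_shift) simp
  finally show ?thesis
    by (subst sum.atMost_Suc_shift) (simp add: distrib_right sum.distrib algebra_simps)
qed

lemma carlitz_sum_0_right: "carlitz_sum q n 0 = 1"
proof -
  have "carlitz_sum q n 0 = (\<Sum>j\<in>{0}. of_nat (n choose j) * ((q - 1) ^ (j - 0) * q_stirling2 q j 0))"
    unfolding carlitz_sum_def by (rule sum.mono_neutral_right) auto
  then show ?thesis by simp
qed

text \<open>Since \<open>(q - 1) [r+1] = q^(r+1) - 1\<close>, the Stirling recurrence gives the
  shifted half of the sum the coefficient \<open>q^(r+1) - 1\<close> at
  \<open>carlitz_sum q n (Suc r)\<close>; the unshifted half supplies the missing 1.\<close>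

lemma carlitz_sum_pascal:
  "carlitz_sum q (Suc n) (Suc r) = carlitz_sum q n r + q ^ Suc r * carlitz_sum q n (Suc r)"
proof -
  have step: "(q - 1) ^ (Suc j - Suc r) * q_stirling2 q (Suc j) (Suc r) =
      (q - 1) ^ (j - r) * q_stirling2 q j r +
      (q ^ Suc r - 1) * ((q - 1) ^ (j - Suc r) * q_stirling2 q j (Suc r))" for j
  proof (cases "Suc r \<le> j")
    case True
    then have "(q - 1) ^ (j - r) = (q - 1) * (q - 1) ^ (j - Suc r)"
      by (metis Suc_diff_le diff_Suc_Suc power_Suc)
    then show ?thesis
      unfolding q_stirling2_Suc_Suc q_int_geometric[symmetric]
      by (simp add: distrib_left mult_ac)
  next
    case False
    then show ?thesis
      unfolding q_stirling2_Suc_Suc by (simp add: q_stirling2_eq_0)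
  qed
  show ?thesis
    unfolding carlitz_sum_def sum_choose_Suc step
    by (simp only: distrib_left sum.distrib mult.left_commute[of "of_nat _"] sum_distrib_left[symmetric])
      (simp add: algebra_simps)
qed

text \<open>After multiplication by \<open>q_fact q r\<close> the left side obeys the same
  \<open>q\<close>-Pascal recurrence as \<open>q_ffact\<close>, with the same boundary
  values.\<close>

lemma carlitz_identity: "q_fact q r * carlitz_sum q n r = q_ffact q n r"
proof (induction n arbitrary: r)
  case 0
  show ?case
    by (cases r) (simp_all add: carlitz_sum_0_right q_fact_def q_ffact_def carlitz_sum_def q_ffact_eq_0)
next
  case (Suc n)
  show ?case
  proof (cases r)
    case 0
    then show ?thesis by (simp add: carlitz_sum_0_right q_fact_def q_ffact_def)
  next
    case (Suc k)
    have "q_fact q (Suc k) * carlitz_sum q (Suc n) (Suc k) =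
        q_int q (Suc k) * (q_fact q k * carlitz_sum q n k) +
        q ^ Suc k * (q_fact q (Suc k) * carlitz_sum q n (Suc k))"
      unfolding carlitz_sum_pascal by (simp add: q_fact_Suc algebra_simps)
    then show ?thesis
      using Suc.IH Suc by (simp only: q_ffact_pascal)
  qed
qed


section \<open>The iterated \<open>q\<close>-derivative\<close>

text \<open>The \<open>q\<close>-derivative of \<open>t^(n+1)\<close> is \<open>[n+1] t^n\<close>,
  by the geometric sum. At \<open>q = 1\<close> the factor \<open>1 / (q - 1)\<close> would be
  0.\<close>

lemma q_deriv_nth:
  assumes "q \<noteq> 1"
  shows "fps_nth (q_deriv q F) n = sf_const (q_int q (Suc n)) * fps_nth F (Suc n)"
proof -
  have pow: "sf_const q ^ k = sf_const (q ^ k)" for k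
    by (induction k) (simp_all add: sf_const_mult)
  have "q_int q (Suc n) = 1 / (q - 1) * (q ^ Suc n - 1)"
    unfolding q_int_geometric[symmetric] using assms by simp
  then have q_int: "sf_const (q_int q (Suc n)) = sf_const (1 / (q - 1)) * (sf_const (q ^ Suc n) - 1)"
    by (simp only: sf_const_mult diff_conv_add_uminus sf_const_add sf_const_uminus sf_const_1)
  have "fps_nth (q_deriv q F) n =
      sf_const (1 / (q - 1)) * (sf_const (q ^ Suc n) * fps_nth F (Suc n) - fps_nth F (Suc n))"
    by (simp add: q_deriv_def fps_compose_linear pow del: power_Suc)
  then show ?thesis
    unfolding q_int by (simp add: algebra_simps del: power_Suc)
qed

lemma q_deriv_funpow_nth:
  assumes "q \<noteq> 1"
  shows "fps_nth ((q_deriv q ^^ r) F) m = sf_const (q_ffact q (m + r) r) * fps_nth F (m + r)"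
  by (induction r arbitrary: m)
    (simp_all add: q_ffact_def q_deriv_nth[OF assms] sf_const_mult mult_ac)


section \<open>Coefficients of symmetric functions\<close>

lemma sf_coeff_add: "sf_coeff (f + g) \<mu> = sf_coeff f \<mu> + sf_coeff g \<mu>"
  by transfer simp

lemma sf_coeff_0 [simp]: "sf_coeff 0 \<mu> = 0"
  by transfer simp

lemma sf_coeff_sum: "sf_coeff (\<Sum>i\<in>I. f i) \<mu> = (\<Sum>i\<in>I. sf_coeff (f i) \<mu>)"
  by (induction I rule: infinite_finite_induct) (simp_all add: sf_coeff_add)

text \<open>Each monomial occurs in exactly one monomial symmetric function, the one indexed by its
  exponent multiset.\<close>

lemma sf_coeff_p:
  "sf_coeff (sf_p n j) \<mu> = (if mon_deg \<mu> = n \<and> card (Poly_Mapping.keys \<mu>) = j then 1 else 0)"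
proof -
  have "sf_coeff (sf_p n j) \<mu> = (\<Sum>L\<in>partitions_parts n j. if mon_exps \<mu> = L then 1 else 0)"
    by (simp add: sf_p_def sf_coeff_sum sf_m.rep_eq)
  also have "\<dots> = (if mon_exps \<mu> \<in> partitions_parts n j then 1 else 0)"
    by simp
  also have "mon_exps \<mu> \<in> partitions_parts n j \<longleftrightarrow>
      mon_deg \<mu> = n \<and> card (Poly_Mapping.keys \<mu>) = j"
    by (auto simp: partitions_parts_def sum_mset_mon_exps size_mon_exps)
      (auto simp: mon_exps_def)
  finally show ?thesis .
qed

section \<open>Squarefree monomials and multiplication by elementary symmetric functions\<close>

definition sqf_mon :: "nat set \<Rightarrow> mon" where
  "sqf_mon A = (\<Sum>i\<in>A. Poly_Mapping.single i 1)"

lemma lookup_sqf_mon: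
  "finite A \<Longrightarrow> Poly_Mapping.lookup (sqf_mon A) i = (if i \<in> A then 1 else 0)"
  by (simp add: sqf_mon_def lookup_sum lookup_single when_def)

lemma keys_sqf_mon: "finite A \<Longrightarrow> Poly_Mapping.keys (sqf_mon A) = A"
  by (auto simp: in_keys_iff lookup_sqf_mon split: if_splits)

lemma mon_deg_sqf_mon: "finite A \<Longrightarrow> mon_deg (sqf_mon A) = card A"
  by (simp add: mon_deg_def keys_sqf_mon lookup_sqf_mon)

lemma sqf_mon_keys:
  assumes "\<And>i. i \<in> Poly_Mapping.keys \<mu> \<Longrightarrow> Poly_Mapping.lookup \<mu> i = 1"
  shows "sqf_mon (Poly_Mapping.keys \<mu>) = \<mu>"
  using assms by (intro poly_mapping_eqI) (auto simp: lookup_sqf_mon in_keys_iff)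

lemma sqf_mon_add_diff:
  assumes "A \<subseteq> Poly_Mapping.keys \<mu>"
  shows "sqf_mon A + (\<mu> - sqf_mon A) = \<mu>"
proof (rule poly_mapping_eqI)
  fix i
  have "finite A" using assms finite_keys by (rule finite_subset)
  with assms show "Poly_Mapping.lookup (sqf_mon A + (\<mu> - sqf_mon A)) i = Poly_Mapping.lookup \<mu> i"
    by (auto simp: lookup_add lookup_minus lookup_sqf_mon in_keys_iff)
qed

text \<open>A factorization of \<mu> contributes only if its first factor is squarefree of degree
  \<open>a\<close>; that factor is determined by its support \<open>A\<close>, and the second factor
  is then forced.\<close>

lemma sf_coeff_e_mult:
  "sf_coeff (sf_e a * g) \<mu> =
    (\<Sum>A | A \<subseteq> Poly_Mapping.keys \<mu> \<and> card A = a. sf_coeff g (\<mu> - sqf_mon A))"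
proof -
  let ?P = "\<lambda>\<alpha> :: mon. card (Poly_Mapping.keys \<alpha>) = a \<and>
    (\<forall>i\<in>Poly_Mapping.keys \<alpha>. Poly_Mapping.lookup \<alpha> i = 1)"
  have "sf_coeff (sf_e a * g) \<mu> =
      (\<Sum>p\<in>mon_splits \<mu>. if ?P (fst p) then sf_coeff g (snd p) else 0)"
    by (auto simp: times_symfun.rep_eq sf_e.rep_eq case_prod_unfold intro!: sum.cong)
  also have "\<dots> = (\<Sum>p | p \<in> mon_splits \<mu> \<and> ?P (fst p). sf_coeff g (snd p))"
    by (rule sum.inter_filter[symmetric]) simp
  also have "\<dots> =
      (\<Sum>A | A \<subseteq> Poly_Mapping.keys \<mu> \<and> card A = a. sf_coeff g (\<mu> - sqf_mon A))"
  proof (rule sum.reindex_bij_witness[of _ "\<lambda>A. (sqf_mon A, \<mu> - sqf_mon A)"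
        "\<lambda>p. Poly_Mapping.keys (fst p)"], goal_cases)
    case (1 p)
    then have "sqf_mon (Poly_Mapping.keys (fst p)) = fst p" "fst p + snd p = \<mu>"
      by (auto simp: mon_splits_def intro!: sqf_mon_keys)
    then show ?case by (metis add_diff_cancel_left' prod.collapse)
  next
    case (2 p)
    then show ?case
      by (auto simp: mon_splits_def in_keys_iff lookup_add)
  next
    case (3 A)
    then have "finite A" using finite_keys finite_subset by blast
    with 3 show ?case by (simp add: keys_sqf_mon)
  next
    case (4 A)
    then have "finite A" using finite_keys finite_subset by blast
    with 4 show ?case by (simp add: keys_sqf_mon lookup_sqf_mon sqf_mon_add_diff)
  next
    case (5 p)
    then have "sqf_mon (Poly_Mapping.keys (fst p)) = fst p" "fst p + snd p = \<mu>"
      by (auto simp: mon_splits_def intro!: sqf_mon_keys)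
    then show ?case by (metis add_diff_cancel_left')
  qed
  finally show ?thesis .
qed

lemma card_keys_le_mon_deg: "card (Poly_Mapping.keys \<mu>) \<le> mon_deg \<mu>"
proof -
  have "card (Poly_Mapping.keys \<mu>) = (\<Sum>i\<in>Poly_Mapping.keys \<mu>. 1)" by simp
  also have "\<dots> \<le> mon_deg \<mu>"
    unfolding mon_deg_def by (rule sum_mono) (simp add: in_keys_iff Suc_le_eq)
  finally show ?thesis .
qed


section \<open>Signed sums over the squarefree divisors of a monomial\<close>

lemma signed_sum_nonsquarefree:
  fixes w :: "nat \<Rightarrow> 'a :: comm_ring_1"
  assumes "2 \<le> Poly_Mapping.lookup \<mu> x"
  shows "(\<Sum>A\<in>Pow (Poly_Mapping.keys \<mu>).
    (-1) ^ card A * w (card (Poly_Mapping.keys (\<mu> - sqf_mon A)))) = 0"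
proof -
  let ?f = "\<lambda>A. (-1) ^ card A * w (card (Poly_Mapping.keys (\<mu> - sqf_mon A)))"
  let ?K = "Poly_Mapping.keys \<mu> - {x}"
  have K: "Poly_Mapping.keys \<mu> = insert x ?K"
    using assms by (auto simp: in_keys_iff)
  have flip: "?f (insert x A) = - ?f A" if "A \<in> Pow ?K" for A
  proof -
    have A: "finite A" "x \<notin> A"
      using that finite_subset[OF _ finite_keys[of \<mu>]] by auto
    \<comment> \<open>Removing one copy of \<open>x\<close> leaves exponent at least 1, so the
      support is the same for both sets.\<close>
    have "Poly_Mapping.keys (\<mu> - sqf_mon (insert x A)) = Poly_Mapping.keys (\<mu> - sqf_mon A)"
      using A assms by (auto simp: in_keys_iff lookup_minus lookup_sqf_mon)
    with A show ?thesis by simp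
  qed
  have "sum ?f (Pow (insert x ?K)) = sum ?f (Pow ?K) + sum ?f (insert x ` Pow ?K)"
    unfolding Pow_insert by (rule sum.union_disjoint) auto
  also have "sum ?f (insert x ` Pow ?K) = (\<Sum>A\<in>Pow ?K. ?f (insert x A))"
    by (subst sum.reindex) (auto simp: inj_on_def)
  also have "\<dots> = - sum ?f (Pow ?K)"
    using flip by (simp add: sum_negf)
  finally show ?thesis using K by simp
qed

lemma sum_Pow_card:
  fixes f :: "nat \<Rightarrow> 'a :: comm_ring_1"
  assumes "finite K"
  shows "(\<Sum>A\<in>Pow K. f (card A)) = (\<Sum>j\<le>card K. of_nat (card K choose j) * f j)"
proof -
  have "(\<Sum>A\<in>Pow K. f (card A)) =
      (\<Sum>j\<le>card K. \<Sum>A | A \<in> Pow K \<and> card A = j. f (card A))"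
    by (rule sum.group[symmetric]) (use assms in \<open>auto intro: card_mono\<close>)
  also have "\<dots> = (\<Sum>j\<le>card K. of_nat (card K choose j) * f j)"
    using assms by (intro sum.cong) (simp_all add: n_subsets)
  finally show ?thesis .
qed

text \<open>Dividing a squarefree monomial by \<open>sqf_mon A\<close> leaves exactly the variables
  outside \<open>A\<close>, so passing to complements groups the terms by the number of remaining
  variables.\<close>

lemma signed_sum_squarefree:
  fixes w :: "nat \<Rightarrow> 'a :: comm_ring_1"
  assumes "\<And>i. i \<in> Poly_Mapping.keys \<mu> \<Longrightarrow> Poly_Mapping.lookup \<mu> i = 1"
  shows "(\<Sum>A\<in>Pow (Poly_Mapping.keys \<mu>).
      (-1) ^ card A * w (card (Poly_Mapping.keys (\<mu> - sqf_mon A)))) =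
    (\<Sum>j\<le>mon_deg \<mu>. of_nat (mon_deg \<mu> choose j) * ((-1) ^ (mon_deg \<mu> - j) * w j))"
proof -
  let ?K = "Poly_Mapping.keys \<mu>"
  have deg: "mon_deg \<mu> = card ?K"
    using assms by (simp add: mon_deg_def)
  have "(\<Sum>A\<in>Pow ?K. (-1) ^ card A * w (card (Poly_Mapping.keys (\<mu> - sqf_mon A)))) =
      (\<Sum>B\<in>Pow ?K. (-1) ^ (card ?K - card B) * w (card B))"
  proof (rule sum.reindex_bij_witness[of _ "\<lambda>B. ?K - B" "\<lambda>A. ?K - A"], goal_cases)
    case (5 A)
    then have A: "A \<subseteq> ?K" "finite A"
      using finite_subset[OF _ finite_keys[of \<mu>]] by auto
    have "Poly_Mapping.lookup \<mu> i = (if i \<in> ?K then 1 else 0)" for i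
      using assms by (auto simp: in_keys_iff)
    with A have "Poly_Mapping.lookup (\<mu> - sqf_mon A) i = (if i \<in> ?K - A then 1 else 0)" for i
      by (auto simp: lookup_minus lookup_sqf_mon)
    then have "Poly_Mapping.keys (\<mu> - sqf_mon A) = ?K - A"
      unfolding set_eq_iff in_keys_iff[of _ "\<mu> - sqf_mon A"] by simp
    moreover have "card A \<le> card ?K" using A by (simp add: card_mono)
    ultimately show ?case using A by (simp add: card_Diff_subset)
  qed auto
  also have "\<dots> = (\<Sum>j\<le>card ?K. of_nat (card ?K choose j) * ((-1) ^ (card ?K - j) * w j))"
    by (rule sum_Pow_card) simp
  finally show ?thesis by (simp only: deg)
qed


section \<open>The generating function\<close>

text \<open>The generating function of the claimed right-hand side; the sign comes from the power of
  \<open>-t\<close>.\<close>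

definition stirling_gf :: "'a :: comm_ring_1 \<Rightarrow> nat \<Rightarrow> 'a symfun fps" where
  "stirling_gf q r = Abs_fps (\<lambda>k. \<Sum>j=r..r+k.
     sf_const ((-1) ^ k * ((1 - q) ^ (j - r) * q_stirling2 q j r)) * sf_p (r + k) j)"

lemma sf_coeff_stirling_gf:
  "sf_coeff (fps_nth (stirling_gf q r) k) \<mu> =
    (if mon_deg \<mu> = r + k
     then (-1) ^ k * ((1 - q) ^ (card (Poly_Mapping.keys \<mu>) - r) *
       q_stirling2 q (card (Poly_Mapping.keys \<mu>)) r)
     else 0)"
proof -
  let ?c = "card (Poly_Mapping.keys \<mu>)"
  let ?w = "\<lambda>j. (-1) ^ k * ((1 - q) ^ (j - r) * q_stirling2 q j r)"
  have "sf_coeff (fps_nth (stirling_gf q r) k) \<mu> =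
      (\<Sum>j=r..r+k. if ?c = j then if mon_deg \<mu> = r + k then ?w j else 0 else 0)"
    by (simp add: stirling_gf_def sf_coeff_sum sf_coeff_const_mult sf_coeff_p if_distrib conj_commute
        cong: if_cong)
      (auto intro!: sum.cong)
  also have "\<dots> = (if ?c \<in> {r..r+k} then if mon_deg \<mu> = r + k then ?w ?c else 0 else 0)"
    by simp
  \<comment> \<open>Below \<open>r\<close> the Stirling number is zero; above \<open>r + k\<close>
    there are more variables than the degree allows.\<close>
  also have "\<dots> = (if mon_deg \<mu> = r + k then ?w ?c else 0)"
    using card_keys_le_mon_deg[of \<mu>] by (auto simp: q_stirling2_eq_0)
  finally show ?thesis .
qed

text \<open>The convolution index is the size of \<open>A\<close>, so the double sum merges into one
  over subsets of the support, and \<open>(-1)^(m-i)\<close> splits off the sign of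
  \<open>A\<close>.\<close>

lemma sf_coeff_E_mult_stirling_gf:
  "sf_coeff (fps_nth (sf_E * stirling_gf q r) m) \<mu> =
    (if mon_deg \<mu> = m + r
     then (-1) ^ m * (\<Sum>A\<in>Pow (Poly_Mapping.keys \<mu>). (-1) ^ card A *
       ((1 - q) ^ (card (Poly_Mapping.keys (\<mu> - sqf_mon A)) - r) *
         q_stirling2 q (card (Poly_Mapping.keys (\<mu> - sqf_mon A))) r))
     else 0)"
proof -
  let ?K = "Poly_Mapping.keys \<mu>"
  let ?c = "\<lambda>A. card (Poly_Mapping.keys (\<mu> - sqf_mon A))"
  let ?w = "\<lambda>j. (1 - q) ^ (j - r) * q_stirling2 q j r"
  let ?f = "\<lambda>A. if mon_deg \<mu> = m + r then (-1) ^ m * ((-1) ^ card A * ?w (?c A)) else 0"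
  have deg: "mon_deg \<mu> = card A + mon_deg (\<mu> - sqf_mon A)" if "A \<subseteq> ?K" for A
    using that finite_subset[OF that finite_keys] sqf_mon_add_diff[OF that]
    by (metis mon_deg_add mon_deg_sqf_mon)
  have term_eq: "sf_coeff (fps_nth (stirling_gf q r) (m - i)) (\<mu> - sqf_mon A) = ?f A"
    if "A \<subseteq> ?K" "card A = i" "i \<le> m" for A i
  proof -
    have "(-1) ^ (m - i) = (-1 :: 'a) ^ m * (-1) ^ i"
      using \<open>i \<le> m\<close> by (simp add: minus_one_power_iff)
    moreover have "mon_deg (\<mu> - sqf_mon A) = r + (m - i) \<longleftrightarrow> mon_deg \<mu> = m + r"
      using deg[OF that(1)] that by auto
    ultimately show ?thesis
      by (simp add: sf_coeff_stirling_gf that mult.assoc)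
  qed
  have "sf_coeff (fps_nth (sf_E * stirling_gf q r) m) \<mu> =
      (\<Sum>i=0..m. \<Sum>A | A \<subseteq> ?K \<and> card A = i. ?f A)"
    unfolding fps_mult_nth sf_coeff_sum sf_E_def fps_nth_Abs_fps sf_coeff_e_mult
    by (intro sum.cong refl, rule term_eq) auto
  also have "\<dots> = (\<Sum>i=0..m. \<Sum>A | A \<in> {A \<in> Pow ?K. card A \<le> m} \<and> card A = i. ?f A)"
    by (intro sum.cong) auto
  also have "\<dots> = sum ?f {A \<in> Pow ?K. card A \<le> m}"
    by (rule sum.group) auto
  also have "\<dots> = sum ?f (Pow ?K)"
  proof (rule sum.mono_neutral_left)
    show "\<forall>A\<in>Pow ?K - {A \<in> Pow ?K. card A \<le> m}. ?f A = 0"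
    proof
      fix A assume A: "A \<in> Pow ?K - {A \<in> Pow ?K. card A \<le> m}"
      \<comment> \<open>Sets with more than \<open>m\<close> elements lie outside the convolution,
        but the quotient then has degree below \<open>r\<close>, hence fewer than \<open>r\<close>
        variables.\<close>
      then have "?c A < r" if "mon_deg \<mu> = m + r"
        using deg[of A] card_keys_le_mon_deg[of "\<mu> - sqf_mon A"] that by auto
      then show "?f A = 0" by (simp add: q_stirling2_eq_0)
    qed
  qed auto
  finally show ?thesis
    by (simp add: sum_distrib_left)
qed

lemma E_mult_stirling_gf_nth:
  "fps_nth (sf_E * stirling_gf q r) m = sf_const (carlitz_sum q (m + r) r) * sf_e (m + r)"
proof (rule symfun_eqI)
  fix \<mu> :: mon
  let ?K = "Poly_Mapping.keys \<mu>"
  let ?w = "\<lambda>j. (1 - q) ^ (j - r) * q_stirling2 q j r"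
  show "sf_coeff (fps_nth (sf_E * stirling_gf q r) m) \<mu> =
      sf_coeff (sf_const (carlitz_sum q (m + r) r) * sf_e (m + r)) \<mu>"
  proof (cases "\<forall>i\<in>?K. Poly_Mapping.lookup \<mu> i = 1")
    case True
    then have deg: "mon_deg \<mu> = card ?K"
      by (simp add: mon_deg_def)
    \<comment> \<open>The two signs combine to \<open>(-1)^(j-r)\<close>, which turns
      \<open>1 - q\<close> into \<open>q - 1\<close>.\<close>
    have "(-1) ^ m * ((-1) ^ (m + r - j) * ?w j) = (q - 1) ^ (j - r) * q_stirling2 q j r"
      if "j \<le> m + r" for j
    proof (cases "r \<le> j")
      case True
      have "(-1) ^ m * (-1) ^ (m + r - j) = (-1 :: 'a) ^ (j - r)"
        using that True by (auto simp: minus_one_power_iff)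
      moreover have "(q - 1) ^ (j - r) = (-1) ^ (j - r) * (1 - q) ^ (j - r)"
        by (simp flip: power_mult_distrib)
      ultimately show ?thesis by (simp add: mult.assoc[symmetric])
    next
      case False
      then show ?thesis by (simp add: q_stirling2_eq_0)
    qed
    then have "(-1) ^ m * (of_nat (m + r choose j) * ((-1) ^ (m + r - j) * ?w j)) =
        of_nat (m + r choose j) * ((q - 1) ^ (j - r) * q_stirling2 q j r)" if "j \<le> m + r" for j
      using that by (subst mult.left_commute) simp
    then have "(-1) ^ m * (\<Sum>j\<le>m + r. of_nat (m + r choose j) * ((-1) ^ (m + r - j) * ?w j)) =
        carlitz_sum q (m + r) r"
      unfolding carlitz_sum_def sum_distrib_left
      by (intro sum.cong) simp_all
    then show ?thesis
      using True deg signed_sum_squarefree[of \<mu> ?w]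
      by (auto simp: sf_coeff_E_mult_stirling_gf sf_coeff_const_mult sf_e.rep_eq)
  next
    case False
    then obtain x where x: "x \<in> ?K" "Poly_Mapping.lookup \<mu> x \<noteq> 1" by blast
    then have "2 \<le> Poly_Mapping.lookup \<mu> x"
      by (simp add: in_keys_iff)
    then show ?thesis
      using False signed_sum_nonsquarefree[of \<mu> x ?w]
      by (auto simp: sf_coeff_E_mult_stirling_gf sf_coeff_const_mult sf_e.rep_eq)
  qed
qed

text \<open>By Carlitz's identity the iterated \<open>q\<close>-derivative of \<open>sf_E\<close> is
  \<open>q_fact q r\<close> times \<open>sf_E * stirling_gf q r\<close>; both factors are then
  cancelled.\<close>

lemma sf_p_gf_eq_stirling_gf:
  assumes "q \<noteq> 1" and "q_fact q r \<noteq> 0"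
  shows "sf_p_gf q r = stirling_gf q r"
proof -
  have D: "(q_deriv q ^^ r) sf_E = fps_const (sf_const (q_fact q r)) * (sf_E * stirling_gf q r)"
    by (rule fps_ext, simp only: fps_mult_left_const_nth E_mult_stirling_gf_nth
        q_deriv_funpow_nth[OF assms(1)] carlitz_identity[symmetric])
      (simp add: sf_const_mult sf_E_def mult.assoc)
  have c: "sf_const (1 / q_fact q r) * sf_const (q_fact q r) = 1"
    using assms(2) by (simp flip: sf_const_mult)
  have "sf_p_gf q r = (fps_const (sf_const (1 / q_fact q r)) * fps_const (sf_const (q_fact q r))) *
      (sf_E * fps_right_inverse sf_E 1) * stirling_gf q r"
    unfolding sf_p_gf_def D by (simp only: mult_ac)
  then show ?thesis
    by (simp add: c sf_E_inverse)
qed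

lemma q_p_eq_sum:
  assumes "q \<noteq> 1" and "q_fact q r \<noteq> 0" and "r \<le> n"
  shows "q_p q n r =
    (\<Sum>j=r..n. sf_const ((1 - q) ^ (j - r) * q_stirling2 q j r) * sf_p n j)"
proof -
  have neg: "sf_const ((-1) ^ k * c) = (-1) ^ k * sf_const c" for k and c :: 'a
    by (cases "even k") (simp_all add: sf_const_uminus)
  have "(-1) ^ k * ((-1) ^ k * f) = f" for k and f :: "'a symfun"
    by (cases "even k") simp_all
  then show ?thesis
    using assms(3)
    by (simp add: q_p_def sf_p_gf_eq_stirling_gf[OF assms(1,2)] stirling_gf_def neg
        sum_distrib_left mult.assoc)
qed

section \<open>Specialization to the field of rational functions in \<open>q\<close>\<close>

lemma q_int_qq_neq_0:
  assumes "n \<noteq> 0"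
  shows "q_int qq n \<noteq> 0"
proof -
  have "qq ^ i = to_fract ([:0, 1:] ^ i)" for i
    by (induction i) (simp_all add: qq_def flip: to_fract_mult)
  then have "q_int qq n = to_fract (\<Sum>i<n. [:0, 1:] ^ i)"
    by (simp add: q_int_def)
  \<comment> \<open>The constant term 1 shows that the polynomial is nonzero.\<close>
  moreover have "poly (\<Sum>i<n. [:0, 1:] ^ i) (0 :: rat) = 1"
    using assms by (simp add: poly_sum power_0_left)
  then have "(\<Sum>i<n. [:0, 1:] ^ i) \<noteq> (0 :: rat poly)"
    by force
  ultimately show ?thesis by (simp only: to_fract_eq_0_iff not_False_eq_True)
qed

theorem theorem4p1:
  fixes n r :: nat
  assumes "1 \<le> r" and "r \<le> n"
  shows "q_p qq n r =
    (\<Sum>j=r..n. sf_const ((1 - qq) ^ (j - r) * q_stirling2 qq j r) * sf_p n j)"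
proof (rule q_p_eq_sum)
  have "[:0, 1:] \<noteq> (1 :: rat poly)"
    by (simp add: one_pCons)
  then show "qq \<noteq> 1"
    by (simp add: qq_def flip: to_fract_1)
  show "q_fact qq r \<noteq> 0"
    by (auto simp: q_fact_def q_int_qq_neq_0)
qed (rule assms)

end
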